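(* Let $a<b$, $c<d$, $\Delta=[a,b]\times[c,d]\subset[0,\infty)^2$, and let $f:\Delta\to[0,\infty)$ be an absolutely continuous function on $\Delta$. Let $s\in(0,1]$, $q\ge1$, and $r_1,r_2\in[0,1]$ be fixed. If $\left|\frac{\partial^2 f}{\partial t\partial\lambda}\right|^q$ is an $s$-convex function on the co-ordinates on $\Delta$, then $$\Bigg|\frac{f(a,c)+r_2f(a,d)+r_1f(b,c)+r_1r_2f(b,d)}{(r_1+1)(r_2+1)}+\frac{1}{(b-a)(d-c)}\int_a^b\int_c^d f(x,y)\,dx\,dy$$ $$-\left(\frac{r_1}{r_1+1}\right)\frac{1}{d-c}\int_c^d f(b,y)\,dy-\left(\frac{1}{r_1+1}\right)\frac{1}{d-c}\int_c^d f(a,y)\,dy-\left(\frac{r_2}{r_2+1}\right)\frac{1}{b-a}\int_a^b f(x,d)\,dx-\left(\frac{1}{r_2+1}\right)\frac{1}{b-a}\int_a^b f(x,c)\,dx\Bigg|$$ $$\le\frac{(b-a)(d-c)}{(r_1+1)(r_2+1)}\left(\frac{(1+r_1^2)(1+r_2^2)}{4(r_1+1)(r_2+1)}\right)^{1-\frac1q}$$ $$\times\left(\frac{MN\left|\frac{\partial^2 f}{\partial t\partial\lambda}\right|^q(a,c)+LM\left|\frac{\partial^2 f}{\partial t\partial\lambda}\right|^q(a,d)+KN\left|\frac{\partial^2 f}{\partial t\partial\lambda}\right|^q(b,c)+KL\left|\frac{\partial^2 f}{\partial t\partial\lambda}\right|^q(b,d)}{(s+1)^2(s+2)^2}\right)^{\frac1q},$$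 where $$M=s+1+2(r_1+1)\left(\frac{r_1}{r_1+1}\right)^{s+2}-r_1,\qquad N=s+1+2(r_2+1)\left(\frac{r_2}{r_2+1}\right)^{s+2}-r_2,$$ $$L=r_2(s+1)+2\left(\frac{1}{r_2+1}\right)^{s+1}-1,\qquad K=r_1(s+1)+2\left(\frac{1}{r_1+1}\right)^{s+1}-1.$$
   Context: $\frac{\partial^2 f}{\partial t\partial\lambda}$ denotes the second-order mixed partial derivative of $f$ with respect to its first and second variables, on $\Delta$. In $\int_a^b\int_c^d f(x,y)\,dx\,dy$ the variable $x$ ranges over $[a,b]$ and $y$ over $[c,d]$. For fixed $s\in(0,1]$, a real function $h$ on an interval in $[0,\infty)$ is $s$-convex (in the second sense) if $h(\alpha x+\beta y)\le\alpha^s h(x)+\beta^s h(y)$ for all $x,y$ in the interval and $\alpha,\beta\ge0$ with $\alpha+\beta=1$. A function $g:[a,b]\times[c,d]\to\mathbb{R}$ is $s$-convex on the co-ordinates if the partial mappings $u\mapsto g(u,y)$ on $[a,b]$ (for every $y\in[c,d]$) and $v\mapsto g(x,v)$ on $[c,d]$ (for every $x\in[a,b]$) are $s$-convex in this sense. *)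

theory Defs
  imports "HOL-Analysis.Analysis"
begin

text \<open>
  \<open>F\<close> is a function of (compact) intervals inside \<open>X\<close>. The families \<open>\<D>\<close> range over the finite
  collections of pairwise non-overlapping intervals contained in \<open>X\<close>; they need not cover \<open>X\<close>.
\<close>

definition abs_cont_interval_fun :: "('a::euclidean_space set \<Rightarrow> real) \<Rightarrow> 'a set \<Rightarrow> bool" where
  "abs_cont_interval_fun F X \<longleftrightarrow>
    (\<forall>\<epsilon>>0. \<exists>\<delta>>0. \<forall>\<D>. \<D> division_of \<Union>\<D> \<and> \<Union>\<D> \<subseteq> X \<and> (\<Sum>K\<in>\<D>. measure lborel K) < \<delta>
      \<longrightarrow> (\<Sum>K\<in>\<D>. \<bar>F K\<bar>) < \<epsilon>)"

definition increment :: "(real \<Rightarrow> real) \<Rightarrow> real set \<Rightarrow> real" where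
  "increment h K = h (interval_upperbound K) - h (interval_lowerbound K)"

definition rect_increment :: "(real \<times> real \<Rightarrow> real) \<Rightarrow> (real \<times> real) set \<Rightarrow> real" where
  "rect_increment f K =
    (let (x\<^sub>0, y\<^sub>0) = interval_lowerbound K; (x\<^sub>1, y\<^sub>1) = interval_upperbound K
     in f (x\<^sub>0, y\<^sub>0) - f (x\<^sub>0, y\<^sub>1) - f (x\<^sub>1, y\<^sub>0) + f (x\<^sub>1, y\<^sub>1))"

definition abs_continuous_on :: "(real \<Rightarrow> real) \<Rightarrow> real set \<Rightarrow> bool" where
  "abs_continuous_on h I \<longleftrightarrow> abs_cont_interval_fun (increment h) I"

text \<open>
  Absolute continuity in the sense of Caratheodory on the rectangle \<open>[a,b] \<times> [c,d]\<close>: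
  absolute continuity of the associated rectangle function together with absolute continuity
  along the two edges issuing from the corner \<open>(a,c)\<close>.
\<close>

definition abs_continuous_on_rect ::
    "real \<Rightarrow> real \<Rightarrow> real \<Rightarrow> real \<Rightarrow> (real \<times> real \<Rightarrow> real) \<Rightarrow> bool" where
  "abs_continuous_on_rect a b c d f \<longleftrightarrow>
    abs_cont_interval_fun (rect_increment f) ({a..b} \<times> {c..d}) \<and>
    abs_continuous_on (\<lambda>x. f (x, c)) {a..b} \<and>
    abs_continuous_on (\<lambda>y. f (a, y)) {c..d}"

text \<open>
  All derivatives are taken within the intervals, hence one-sided on the boundary of the
  rectangle. \<open>mixed_partial S T f\<close> differentiates first in the second and then in the first
  variable. It is a total function by underspecification and is meaningful only together with
  \<open>has_mixed_partial_on\<close>.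
\<close>

definition partial_snd :: "real set \<Rightarrow> (real \<times> real \<Rightarrow> real) \<Rightarrow> real \<times> real \<Rightarrow> real" where
  "partial_snd T f = (\<lambda>(x, y). vector_derivative (\<lambda>v. f (x, v)) (at y within T))"

definition mixed_partial ::
    "real set \<Rightarrow> real set \<Rightarrow> (real \<times> real \<Rightarrow> real) \<Rightarrow> real \<times> real \<Rightarrow> real" where
  "mixed_partial S T f =
    (\<lambda>(x, y). vector_derivative (\<lambda>u. partial_snd T f (u, y)) (at x within S))"

definition has_mixed_partial_on ::
    "real set \<Rightarrow> real set \<Rightarrow> (real \<times> real \<Rightarrow> real) \<Rightarrow> bool" where
  "has_mixed_partial_on S T f \<longleftrightarrow>
    (\<forall>x\<in>S. \<forall>y\<in>T. (\<lambda>v. f (x, v)) differentiable (at y within T) \<and>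
      (\<lambda>u. partial_snd T f (u, y)) differentiable (at x within S))"

text \<open>
  Convexity in the second sense, for \<open>0 < s \<le> 1\<close> and an interval \<open>I \<subseteq> [0,\<infinity>)\<close>.
  Since \<open>0 powr s = 0\<close>, the weights \<open>\<alpha> = 0\<close> and \<open>\<beta> = 0\<close> are treated correctly.
\<close>

definition s_convex_on :: "real \<Rightarrow> real set \<Rightarrow> (real \<Rightarrow> real) \<Rightarrow> bool" where
  "s_convex_on s I h \<longleftrightarrow>
    (\<forall>x\<in>I. \<forall>y\<in>I. \<forall>\<alpha>\<ge>0. \<forall>\<beta>\<ge>0. \<alpha> + \<beta> = 1 \<longrightarrow>
      h (\<alpha> * x + \<beta> * y) \<le> \<alpha> powr s * h x + \<beta> powr s * h y)"

definition s_convex_on_coords ::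
    "real \<Rightarrow> real set \<Rightarrow> real set \<Rightarrow> (real \<times> real \<Rightarrow> real) \<Rightarrow> bool" where
  "s_convex_on_coords s S T g \<longleftrightarrow>
    (\<forall>y\<in>T. s_convex_on s S (\<lambda>u. g (u, y))) \<and>
    (\<forall>x\<in>S. s_convex_on s T (\<lambda>v. g (x, v)))"

end

theory Submission
  imports Defs
begin

text \<open>
  Put \<open>A g = g a + r\<^sub>1 g b - (r\<^sub>1 + 1)/(b - a) \<integral> g\<close>; integration by parts turns it into
  \<open>\<integral> ((r\<^sub>1 + 1)(x - a)/(b - a) - 1) g' x dx\<close>. Up to the factor \<open>(r\<^sub>1 + 1)(r\<^sub>2 + 1)\<close> the quantity to be
  estimated is \<open>A \<phi>\<close>, where \<open>\<phi> x\<close> is the analogous functional of \<open>f (x, \<cdot>)\<close> on \<open>[c, d]\<close>.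
  By \<open>s\<close>-convexity the mixed derivative \<open>D\<close> is bounded by its values at the four corners, so
  \<open>\<phi>\<close> can be differentiated under the integral sign. The power mean inequality with the kernel as
  weight, followed by \<open>s\<close>-convexity, is then applied once in \<open>y\<close> (to bound \<open>\<phi>'\<close>) and once in \<open>x\<close>.
  Working with one variable at a time avoids measurability of \<open>D\<close> on the plane and Fubini's theorem.
\<close>

section \<open>Integration tools in one variable\<close>

text \<open>Power mean inequality with weight \<open>w\<close> of mass \<open>W\<close>, by
  integrating Young's inequality. The bounded integral is that of \<open>F\<close>, because
  \<open>w x * H x powr (1 / q)\<close> is not known to be integrable.\<close>

lemma powr_weighted_has_integral_bound:
  fixes F w H :: "real \<Rightarrow> real"
  assumes F: "(F has_integral I) S"
    and w: "(w has_integral W) S"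
    and wH: "((\<lambda>x. w x * H x) has_integral Z) S"
    and F_le: "\<And>x. x \<in> S \<Longrightarrow> \<bar>F x\<bar> \<le> w x * H x powr (1 / q)"
    and w_nonneg: "\<And>x. x \<in> S \<Longrightarrow> 0 \<le> w x"
    and H_nonneg: "\<And>x. x \<in> S \<Longrightarrow> 0 \<le> H x"
    and "1 \<le> q" and "0 < W"
  shows "\<bar>I\<bar> \<le> W powr (1 - 1 / q) * Z powr (1 / q)"
proof -
  have Z: "0 \<le> Z"
    using has_integral_nonneg[OF wH] w_nonneg H_nonneg by simp
  \<comment> \<open>Young's inequality needs a positive second factor, so \<open>Z\<close> is approached from above by \<open>Y\<close>.\<close>
  have *: "\<bar>I\<bar> \<le> W powr (1 - 1 / q) * Y powr (1 / q)" if "Z \<le> Y" "0 < Y" for Y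
  proof -
    \<comment> \<open>With this factor Young's inequality is an equality where
      \<open>H x = Y / W\<close>; multiplied by \<open>w\<close> and integrated, its right side is
      at most \<open>Y\<close>.\<close>
    define A where "A = (Y / W) powr (1 - 1 / q)"
    have A: "0 < A" using that \<open>0 < W\<close> by (simp add: A_def)
    have young: "H x powr (1 / q) * A \<le> 1 / q * H x + (1 - 1 / q) * (Y / W)" if "x \<in> S" for x
    proof (cases "H x = 0")
      case True
      then show ?thesis using \<open>1 \<le> q\<close> \<open>0 < Y\<close> \<open>0 < W\<close> by simp
    next
      case False
      then show ?thesis
        unfolding A_def using H_nonneg[OF that] \<open>1 \<le> q\<close> \<open>0 < Y\<close> \<open>0 < W\<close>
        by (intro Youngs_inequality_0) auto
    qed
    have int: "((\<lambda>x. 1 / q * (w x * H x) + (1 - 1 / q) * (Y / W) * w x) has_integral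
        (1 / q * Z + (1 - 1 / q) * (Y / W) * W)) S"
      by (intro has_integral_add has_integral_mult_right w wH)
    have FA: "((\<lambda>x. A * F x) has_integral A * I) S"
      by (intro has_integral_mult_right F)
    have le: "norm (A * F x) \<le> 1 / q * (w x * H x) + (1 - 1 / q) * (Y / W) * w x" if "x \<in> S" for x
    proof -
      have "norm (A * F x) = A * \<bar>F x\<bar>"
        using A by (simp add: abs_mult)
      also have "\<dots> \<le> A * (w x * H x powr (1 / q))"
        using A F_le[OF that] by (intro mult_left_mono) auto
      also have "\<dots> = w x * (H x powr (1 / q) * A)" by simp
      also have "\<dots> \<le> w x * (1 / q * H x + (1 - 1 / q) * (Y / W))"
        by (intro mult_left_mono young w_nonneg that)
      finally show ?thesis by (simp add: algebra_simps)
    qed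
    have "A * \<bar>I\<bar> = norm (integral S (\<lambda>x. A * F x))"
      unfolding integral_unique[OF FA] using A by (simp add: abs_mult)
    also have "\<dots> \<le> 1 / q * Z + (1 - 1 / q) * (Y / W) * W"
      using integral_norm_bound_integral[OF has_integral_integrable[OF FA] has_integral_integrable[OF int] le]
        integral_unique[OF int] by simp
    also have "\<dots> = 1 / q * Z + (1 - 1 / q) * Y" using \<open>0 < W\<close> by simp
    also have "\<dots> \<le> 1 / q * Y + (1 - 1 / q) * Y"
      using \<open>Z \<le> Y\<close> \<open>1 \<le> q\<close> by (intro add_right_mono mult_left_mono) auto
    also have "\<dots> = Y" by (simp add: algebra_simps)
    finally have "\<bar>I\<bar> \<le> Y / A" using A by (simp add: field_simps)
    also have "Y / A = Y powr 1 * W powr (1 - 1 / q) / Y powr (1 - 1 / q)"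
      using that \<open>0 < W\<close> by (simp add: A_def powr_divide)
    also have "\<dots> = W powr (1 - 1 / q) * Y powr (1 - (1 - 1 / q))"
      using powr_diff[of Y 1 "1 - 1 / q"] by simp
    finally show ?thesis by simp
  qed
  \<comment> \<open>Now \<open>Y\<close> decreases to \<open>Z\<close>. Since
    \<open>1 / q > 0\<close>, the limit is right even if \<open>Z = 0\<close>.\<close>
  have "((\<lambda>Y. W powr (1 - 1 / q) * Y powr (1 / q)) \<longlongrightarrow> W powr (1 - 1 / q) * Z powr (1 / q)) (at_right Z)"
    using \<open>1 \<le> q\<close> Z
    by (intro tendsto_mult tendsto_const tendsto_powr' tendsto_ident_at disjI2 conjI)
      (auto simp: eventually_at_right_less intro: eventually_mono[OF eventually_at_right_less[of Z]])
  moreover have "\<forall>\<^sub>F Y in at_right Z. \<bar>I\<bar> \<le> W powr (1 - 1 / q) * Y powr (1 / q)"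
    using eventually_at_right_less[of Z] by eventually_elim (use * Z in auto)
  ultimately show ?thesis
    by (rule tendsto_lowerbound) simp
qed

text \<open>Splitting at \<open>\<sigma>\<close> resolves the absolute value. With an antiderivative
  \<open>G\<close> the result is \<open>G 1 + G 0 - 2 * G \<sigma>\<close>, whence the term
  \<open>2 * \<sigma> powr (s + 2)\<close>.\<close>

lemma has_integral_abs_diff_powr:
  fixes s \<sigma> :: real
  assumes "0 \<le> s" and "0 \<le> \<sigma>" and "\<sigma> \<le> 1"
  shows "((\<lambda>u. \<bar>u - \<sigma>\<bar> * u powr s) has_integral
    (s + 1 - \<sigma> * (s + 2) + 2 * \<sigma> powr (s + 2)) / ((s + 1) * (s + 2))) {0..1}"
proof -
  \<comment> \<open>Antiderivative of \<open>(u - \<sigma>) * u powr s\<close> for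
    \<open>u > 0\<close>; at \<open>0\<close> only its continuity is used, by the interior form of
    the fundamental theorem.\<close>
  define G where "G = (\<lambda>u. u powr (s + 2) / (s + 2) - \<sigma> * (u powr (s + 1) / (s + 1)))"
  have cont: "continuous_on {p..r} G" if "0 \<le> p" for p r
    unfolding G_def using assms that
    by (intro continuous_intros continuous_on_powr') auto
  have der: "(G has_vector_derivative (u - \<sigma>) * u powr s) (at u)" if "0 < u" for u
  proof -
    have 1: "((\<lambda>u. u powr (s + 1)) has_real_derivative (s + 1) * u powr s) (at u)"
      using has_real_derivative_powr[OF that, of "s + 1"] by simp
    have 2: "((\<lambda>u. u powr (s + 2)) has_real_derivative (s + 2) * (u * u powr s)) (at u)"
      using has_real_derivative_powr[OF that, of "s + 2"] powr_mult_base[of u s] that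
      by (simp add: add.commute)
    have "(G has_real_derivative
        (s + 2) * (u * u powr s) / (s + 2) - \<sigma> * ((s + 1) * u powr s / (s + 1))) (at u)"
      unfolding G_def by (intro DERIV_diff DERIV_cdivide DERIV_cmult 1 2)
    then show ?thesis
      unfolding has_real_derivative_iff_has_vector_derivative[symmetric] using assms
      by (simp add: left_diff_distrib)
  qed
  have 1: "((\<lambda>u. (u - \<sigma>) * u powr s) has_integral G \<sigma> - G 0) {0..\<sigma>}"
    using assms by (intro fundamental_theorem_of_calculus_interior cont der) auto
  have 2: "((\<lambda>u. (u - \<sigma>) * u powr s) has_integral G 1 - G \<sigma>) {\<sigma>..1}"
    using assms by (intro fundamental_theorem_of_calculus_interior cont der) auto
  have "((\<lambda>u. \<bar>u - \<sigma>\<bar> * u powr s) has_integral - (G \<sigma> - G 0) + (G 1 - G \<sigma>)) {0..1}"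
  proof (rule has_integral_combine[of 0 \<sigma> 1])
    show "((\<lambda>u. \<bar>u - \<sigma>\<bar> * u powr s) has_integral - (G \<sigma> - G 0)) {0..\<sigma>}"
      by (rule has_integral_eq[OF _ has_integral_neg[OF 1]]) (auto simp: algebra_simps)
    show "((\<lambda>u. \<bar>u - \<sigma>\<bar> * u powr s) has_integral (G 1 - G \<sigma>)) {\<sigma>..1}"
      by (rule has_integral_eq[OF _ 2]) auto
  qed (use assms in auto)
  moreover have "\<sigma> * \<sigma> powr (s + 1) = \<sigma> powr (s + 2)"
    using powr_mult_base[of \<sigma> "s + 1"] assms by (simp add: add.commute)
  hence "- (G \<sigma> - G 0) + (G 1 - G \<sigma>)
      = (s + 1 - \<sigma> * (s + 2) + 2 * \<sigma> powr (s + 2)) / ((s + 1) * (s + 2))"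
    using assms by (simp add: G_def divide_simps) (simp add: algebra_simps)
  ultimately show ?thesis by simp
qed

text \<open>A uniform bound on \<open>F'\<close> takes the place of continuity. Along any sequence
  tending to \<open>x\<close> the difference quotients are bounded by \<open>C\<close> and converge
  pointwise, so dominated convergence yields both the integrability of \<open>F' x\<close> and the
  derivative.\<close>

lemma leibniz_rule_bounded_derivative:
  fixes F F' :: "real \<Rightarrow> real \<Rightarrow> real"
  assumes F: "\<And>u. u \<in> {a..b} \<Longrightarrow> F u integrable_on {c..d}"
    and F': "\<And>u y. u \<in> {a..b} \<Longrightarrow> y \<in> {c..d} \<Longrightarrow>
      ((\<lambda>u. F u y) has_real_derivative F' u y) (at u within {a..b})"
    and F'_le: "\<And>u y. u \<in> {a..b} \<Longrightarrow> y \<in> {c..d} \<Longrightarrow> \<bar>F' u y\<bar> \<le> C"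
    and "a < b" and x: "x \<in> {a..b}"
  shows "F' x integrable_on {c..d}"
    and "((\<lambda>u. integral {c..d} (F u)) has_real_derivative integral {c..d} (F' x)) (at x within {a..b})"
proof -
  have *: "F' x integrable_on {c..d} \<and>
      (\<lambda>k. (integral {c..d} (F (X k)) - integral {c..d} (F x)) / (X k - x))
        \<longlonglongrightarrow> integral {c..d} (F' x)"
    if X: "\<And>k. X k \<in> {a..b} - {x}" and lim: "X \<longlonglongrightarrow> x" for X
  proof -
    define Q where "Q = (\<lambda>k y. (F (X k) y - F x y) / (X k - x))"
    have Q: "(Q k has_integral
        (integral {c..d} (F (X k)) - integral {c..d} (F x)) / (X k - x)) {c..d}" for k
      unfolding Q_def using F[of "X k"] F[OF x] X[of k]
      by (intro has_integral_divide has_integral_diff integrable_integral) auto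
    have Q_le: "norm (Q k y) \<le> C" if "y \<in> {c..d}" for k y
    proof -
      \<comment> \<open>Mean value inequality on the convex set \<open>{a..b}\<close>, uniform in
        \<open>k\<close> and \<open>y\<close>.\<close>
      have "norm (F (X k) y - F x y) \<le> C * norm (X k - x)"
        using X[of k] F' F'_le that x
        by (intro field_differentiable_bound[of "{a..b}" "\<lambda>u. F u y" "\<lambda>u. F' u y"]) auto
      thus ?thesis using X[of k] by (simp add: Q_def pos_divide_le_eq)
    qed
    have Q_lim: "(\<lambda>k. Q k y) \<longlonglongrightarrow> F' x y" if "y \<in> {c..d}" for y
      using F'[OF x that] X lim unfolding Q_def has_field_derivative_iff tendsto_at_iff_sequentially
      by (auto simp: o_def)
    note dominated_convergence[OF has_integral_integrable[OF Q] integrable_const_ivl Q_le Q_lim]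
    moreover have "integral {c..d} (Q k) = (integral {c..d} (F (X k)) - integral {c..d} (F x)) / (X k - x)" for k
      using Q by (rule integral_unique)
    ultimately show ?thesis by simp
  qed
  show "((\<lambda>u. integral {c..d} (F u)) has_real_derivative integral {c..d} (F' x)) (at x within {a..b})"
    unfolding has_field_derivative_iff tendsto_at_iff_sequentially using * by (auto simp: o_def)
  \<comment> \<open>Integrability of \<open>F' x\<close> follows once a single admissible sequence
    exists; \<open>a < b\<close> provides one.\<close>
  have "x islimpt {a..b}"
    using \<open>a < b\<close> x islimpt_Icc by blast
  then obtain X where "\<And>k. X k \<in> {a..b} - {x}" "X \<longlonglongrightarrow> x"
    unfolding islimpt_sequential by blast
  with * show "F' x integrable_on {c..d}" by blast
qed

text \<open>Integration by parts: the fundamental theorem applied to \<open>k * g\<close>, where the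
  affine kernel \<open>k\<close> has slope \<open>(r + 1) / (b - a)\<close> and end values
  \<open>- 1\<close> and \<open>r\<close>. The gauge integral gives integrability from
  differentiability of \<open>g\<close> alone.\<close>

lemma has_integral_affine_kernel_derivative:
  fixes g g' :: "real \<Rightarrow> real"
  assumes "a < b"
    and g: "\<And>x. x \<in> {a..b} \<Longrightarrow> (g has_real_derivative g' x) (at x within {a..b})"
  shows "((\<lambda>x. ((r + 1) * ((x - a) / (b - a)) - 1) * g' x) has_integral
    g a + r * g b - (r + 1) / (b - a) * integral {a..b} g) {a..b}"
proof -
  have "continuous_on {a..b} g"
    using g DERIV_continuous continuous_on_eq_continuous_within by blast
  hence int: "(g has_integral integral {a..b} g) {a..b}"
    using integrable_continuous_real integrable_integral by blast
  define k where "k x = (r + 1) * ((x - a) / (b - a)) - 1" for x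
  have k: "k a = - 1" "k b = r" using \<open>a < b\<close> by (simp_all add: k_def)
  have "((\<lambda>x. k x * g' x + (r + 1) / (b - a) * g x) has_integral k b * g b - k a * g a) {a..b}"
    using \<open>a < b\<close>
    by (intro fundamental_theorem_of_calculus)
      (auto simp: has_real_derivative_iff_has_vector_derivative[symmetric] k_def
        intro!: derivative_eq_intros g)
  from has_integral_diff[OF this has_integral_mult_right[OF int, of "(r + 1) / (b - a)"]]
  show ?thesis unfolding k unfolding k_def by (simp add: add.commute)
qed

section \<open>Consequences of absolute continuity and of s-convexity\<close>

text \<open>The family consisting of the single interval between \<open>x\<close> and
  \<open>x'\<close> suffices.\<close>

lemma abs_continuous_on_imp_continuous_on:
  assumes "abs_continuous_on h {a..b}"
  shows "continuous_on {a..b} h"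
  unfolding continuous_on_iff
proof (intro ballI allI impI)
  fix x e :: real
  assume x: "x \<in> {a..b}" and "0 < e"
  then obtain \<delta> where "\<delta> > 0" and
    \<delta>: "\<And>\<D>. \<D> division_of \<Union>\<D> \<Longrightarrow> \<Union>\<D> \<subseteq> {a..b} \<Longrightarrow> (\<Sum>K\<in>\<D>. measure lborel K) < \<delta>
      \<Longrightarrow> (\<Sum>K\<in>\<D>. \<bar>increment h K\<bar>) < e"
    using assms unfolding abs_continuous_on_def abs_cont_interval_fun_def by meson
  have "dist (h x') (h x) < e" if x': "x' \<in> {a..b}" and "dist x' x < \<delta>" for x'
  proof -
    define K where "K = cbox (min x x') (max x x')"
    have "cbox (min x x') (max x x') \<noteq> {}" by simp
    hence "{K} division_of \<Union>{K}"
      unfolding K_def using division_of_self by (metis ccpo_Sup_singleton)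
    moreover have "\<Union>{K} \<subseteq> {a..b}" using x x' by (auto simp: K_def)
    moreover have "(\<Sum>K\<in>{K}. measure lborel K) < \<delta>"
      using \<open>dist x' x < \<delta>\<close> by (auto simp: K_def dist_real_def min_def max_def)
    ultimately have "(\<Sum>K\<in>{K}. \<bar>increment h K\<bar>) < e" by (rule \<delta>)
    thus ?thesis by (auto simp: K_def increment_def dist_real_def min_def max_def split: if_splits)
  qed
  with \<open>\<delta> > 0\<close> show "\<exists>\<delta>>0. \<forall>x'\<in>{a..b}. dist x' x < \<delta> \<longrightarrow> dist (h x') (h x) < e" by blast
qed

lemma s_convex_on_endpoints:
  assumes "s_convex_on s {a..b} h" and "a < b" and "x \<in> {a..b}"
  shows "h x \<le> ((b - x) / (b - a)) powr s * h a + ((x - a) / (b - a)) powr s * h b"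
proof -
  define u where "u = (x - a) / (b - a)"
  have u: "(b - x) / (b - a) = 1 - u" "x - a = u * (b - a)"
    using \<open>a < b\<close> by (simp_all add: u_def field_simps)
  have "(b - x) / (b - a) + (x - a) / (b - a) = 1"
    unfolding u(1) by (simp add: u_def)
  moreover have "(b - x) / (b - a) * a + (x - a) / (b - a) * b = x"
    unfolding u(1) using u(2) by (simp add: algebra_simps flip: u_def)
  ultimately show ?thesis
    using assms unfolding s_convex_on_def
    by (metis atLeastAtMost_iff diff_ge_0_iff_ge divide_nonneg_nonneg less_eq_real_def)
qed

section \<open>Moments of the affine kernel\<close>

text \<open>Integral of \<open>\<bar>(r + 1) * t - 1\<bar> * (1 - t) powr s\<close> over the unit
  interval, the coefficient of the value at the left endpoint. For \<open>r\<^sub>1\<close> and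
  \<open>r\<^sub>2\<close> it is \<open>M\<close> and \<open>N\<close> over
  \<open>(s + 1) * (s + 2)\<close>.\<close>

definition near_weight :: "real \<Rightarrow> real \<Rightarrow> real" where
  "near_weight s r = (s + 1 + 2 * (r + 1) * (r / (r + 1)) powr (s + 2) - r) / ((s + 1) * (s + 2))"

text \<open>The same with \<open>t powr s\<close>, the coefficient of the value at the right
  endpoint; it gives \<open>K\<close> and \<open>L\<close>.\<close>

definition far_weight :: "real \<Rightarrow> real \<Rightarrow> real" where
  "far_weight s r = (r * (s + 1) + 2 * (1 / (r + 1)) powr (s + 1) - 1) / ((s + 1) * (s + 2))"

text \<open>The kernel vanishes at \<open>\<rho> = 1 / (r + 1)\<close>, so its absolute value is
  \<open>(r + 1) * \<bar>t - \<rho>\<bar>\<close>.\<close>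

lemma has_integral_far_weight:
  assumes "0 \<le> s" and "0 \<le> r"
  shows "((\<lambda>t. \<bar>(r + 1) * t - 1\<bar> * t powr s) has_integral far_weight s r) {0..1}"
proof -
  define \<rho> where "\<rho> = 1 / (r + 1)"
  have \<rho>: "0 < \<rho>" "\<rho> \<le> 1" "(r + 1) * \<rho> = 1" using assms by (auto simp: \<rho>_def)
  have int: "((\<lambda>t. (r + 1) * (\<bar>t - \<rho>\<bar> * t powr s)) has_integral
      (r + 1) * ((s + 1 - \<rho> * (s + 2) + 2 * \<rho> powr (s + 2)) / ((s + 1) * (s + 2)))) {0..1}"
    using assms \<rho> by (intro has_integral_mult_right has_integral_abs_diff_powr) auto
  have "(r + 1) * \<bar>t - \<rho>\<bar> = \<bar>(r + 1) * t - 1\<bar>" for t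
    using assms abs_mult[of "r + 1" "t - \<rho>"] \<rho>(3) by (simp add: right_diff_distrib)
  hence eq: "(r + 1) * (\<bar>t - \<rho>\<bar> * t powr s) = \<bar>(r + 1) * t - 1\<bar> * t powr s" for t
    by (metis mult.assoc)
  \<comment> \<open>The split factor \<open>\<rho>\<close> cancels against \<open>r + 1\<close>,
    which leaves the exponent \<open>s + 1\<close> of \<open>far_weight\<close>.\<close>
  have pow: "\<rho> powr (s + 2) = \<rho> * \<rho> powr (s + 1)"
    using powr_mult_base[of \<rho> "s + 1"] \<rho> by (simp add: add.commute)
  have "(r + 1) * (s + 1 - \<rho> * (s + 2) + 2 * \<rho> powr (s + 2))
      = (r + 1) * (s + 1) - ((r + 1) * \<rho>) * (s + 2) + 2 * ((r + 1) * \<rho>) * \<rho> powr (s + 1)"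
    unfolding pow by (simp add: algebra_simps)
  also have "\<dots> = r * (s + 1) + 2 * \<rho> powr (s + 1) - 1"
    unfolding \<rho>(3) by (simp add: algebra_simps)
  finally have "(r + 1) * ((s + 1 - \<rho> * (s + 2) + 2 * \<rho> powr (s + 2)) / ((s + 1) * (s + 2))) = far_weight s r"
    by (simp add: far_weight_def \<rho>_def)
  with int show ?thesis by (simp only: eq)
qed

text \<open>Replacing \<open>t\<close> by \<open>1 - t\<close> moves the zero of the kernel to
  \<open>\<sigma> = r / (r + 1)\<close> and reduces the integral to a moment with
  \<open>t powr s\<close>.\<close>

lemma has_integral_near_weight:
  assumes "0 \<le> s" and "0 \<le> r"
  shows "((\<lambda>t. \<bar>(r + 1) * t - 1\<bar> * (1 - t) powr s) has_integral near_weight s r) {0..1}"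
proof -
  define \<sigma> where "\<sigma> = r / (r + 1)"
  have \<sigma>: "0 \<le> \<sigma>" "\<sigma> \<le> 1" "(r + 1) * \<sigma> = r" using assms by (auto simp: \<sigma>_def)
  have "((\<lambda>t. (r + 1) * (\<bar>t - \<sigma>\<bar> * t powr s)) has_integral
      (r + 1) * ((s + 1 - \<sigma> * (s + 2) + 2 * \<sigma> powr (s + 2)) / ((s + 1) * (s + 2)))) (cbox 0 1)"
    using assms \<sigma> has_integral_mult_right[OF has_integral_abs_diff_powr] by simp
  from has_integral_affinity[OF this, of "-1" 1]
  have int: "((\<lambda>t. (r + 1) * (\<bar>1 - t - \<sigma>\<bar> * (1 - t) powr s)) has_integral
      (r + 1) * ((s + 1 - \<sigma> * (s + 2) + 2 * \<sigma> powr (s + 2)) / ((s + 1) * (s + 2)))) {0..1}"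
    by (simp add: image_affinity_atLeastAtMost[of "-1" 1, simplified])
  have "(r + 1) * \<bar>1 - t - \<sigma>\<bar> = \<bar>(r + 1) * t - 1\<bar>" for t
    using assms abs_mult[of "r + 1" "1 - t - \<sigma>"] \<sigma>(3) by (simp add: right_diff_distrib)
  hence eq: "(r + 1) * (\<bar>1 - t - \<sigma>\<bar> * (1 - t) powr s) = \<bar>(r + 1) * t - 1\<bar> * (1 - t) powr s" for t
    by (metis mult.assoc)
  have "(r + 1) * (s + 1 - \<sigma> * (s + 2) + 2 * \<sigma> powr (s + 2))
      = (r + 1) * (s + 1) - ((r + 1) * \<sigma>) * (s + 2) + 2 * (r + 1) * \<sigma> powr (s + 2)"
    by (simp add: algebra_simps)
  also have "\<dots> = s + 1 + 2 * (r + 1) * \<sigma> powr (s + 2) - r"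
    unfolding \<sigma>(3) by (simp add: algebra_simps)
  finally have "(r + 1) * ((s + 1 - \<sigma> * (s + 2) + 2 * \<sigma> powr (s + 2)) / ((s + 1) * (s + 2))) = near_weight s r"
    by (simp add: near_weight_def \<sigma>_def)
  with int show ?thesis by (simp only: eq)
qed

text \<open>This is the mass \<open>W\<close> in the power mean inequality. It is the far moment for
  \<open>s = 0\<close>.\<close>

lemma has_integral_total_weight:
  fixes r :: real
  assumes "0 \<le> r"
  shows "((\<lambda>t. \<bar>(r + 1) * t - 1\<bar>) has_integral (1 + r\<^sup>2) / (2 * (r + 1))) {0..1}"
proof -
  \<comment> \<open>The integrands differ at \<open>t = 0\<close>, since \<open>0 powr 0 = 0\<close>.\<close>
  have "((\<lambda>t. \<bar>(r + 1) * t - 1\<bar>) has_integral far_weight 0 r) {0..1}"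
    by (rule has_integral_spike_finite[OF _ _ has_integral_far_weight[of 0 r], of "{0}"])
      (use assms in auto)
  moreover have "far_weight 0 r = (1 + r\<^sup>2) / (2 * (r + 1))"
    using assms by (simp add: far_weight_def field_simps power2_eq_square)
  ultimately show ?thesis by simp
qed

lemma near_weight_nonneg: "0 \<le> s \<Longrightarrow> 0 \<le> r \<Longrightarrow> 0 \<le> near_weight s r"
  by (rule has_integral_nonneg[OF has_integral_near_weight]) auto

lemma far_weight_nonneg: "0 \<le> s \<Longrightarrow> 0 \<le> r \<Longrightarrow> 0 \<le> far_weight s r"
  by (rule has_integral_nonneg[OF has_integral_far_weight]) auto

lemma has_integral_unit_rescale:
  fixes g :: "real \<Rightarrow> real"
  assumes "(g has_integral J) {0..1}" and "a < b"
  shows "((\<lambda>x. g ((x - a) / (b - a)) / (b - a)) has_integral J) {a..b}"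
proof -
  have "((\<lambda>x. g (inverse (b - a) *\<^sub>R x + - a / (b - a))) has_integral J /\<^sub>R inverse (b - a) ^ DIM(real))
      (cbox ((0 - - a / (b - a)) /\<^sub>R inverse (b - a)) ((1 - - a / (b - a)) /\<^sub>R inverse (b - a)))"
    by (rule has_integral_affinity') (use assms in auto)
  also have "(0 - - a / (b - a)) /\<^sub>R inverse (b - a) = a"
    using \<open>a < b\<close> by simp
  also have "(1 - - a / (b - a)) /\<^sub>R inverse (b - a) = b"
    using \<open>a < b\<close> by (simp add: field_simps)
  also have "(\<lambda>x. g (inverse (b - a) *\<^sub>R x + - a / (b - a))) = (\<lambda>x. g ((x - a) / (b - a)))"
    by (simp add: divide_inverse algebra_simps)
  finally have "((\<lambda>x. g ((x - a) / (b - a))) has_integral J * (b - a)) {a..b}"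
    by (simp add: mult.commute)
  from has_integral_divide[OF this, of "b - a"] show ?thesis
    using \<open>a < b\<close> by simp
qed

section \<open>The estimate in one variable\<close>

text \<open>Power mean inequality with the endpoint bound of an s-convex function as
  \<open>H\<close>. Since \<open>h\<close> is only bounded pointwise, the lemma serves in
  \<open>y\<close> for the mixed derivative and in \<open>x\<close> for the rescaled derivative of
  the inner functional.\<close>

lemma affine_kernel_integral_bound:
  fixes h :: "real \<Rightarrow> real"
  assumes "a < b" and "0 \<le> s" and "0 \<le> r" and "1 \<le> q" and "0 \<le> U" and "0 \<le> V"
    and int: "((\<lambda>x. ((r + 1) * ((x - a) / (b - a)) - 1) * h x) has_integral I) {a..b}"
    and h: "\<And>x. x \<in> {a..b} \<Longrightarrow>
      \<bar>h x\<bar> \<le> (((b - x) / (b - a)) powr s * U + ((x - a) / (b - a)) powr s * V) powr (1 / q)"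
  shows "\<bar>I\<bar> \<le> (b - a) * ((1 + r\<^sup>2) / (2 * (r + 1))) powr (1 - 1 / q)
    * (near_weight s r * U + far_weight s r * V) powr (1 / q)"
proof -
  \<comment> \<open>Dividing by \<open>b - a\<close> reduces the integrals to the unit interval; the
    factor returns in the last step.\<close>
  define w where "w = (\<lambda>x. \<bar>(r + 1) * ((x - a) / (b - a)) - 1\<bar> / (b - a))"
  define H where "H = (\<lambda>x. ((b - x) / (b - a)) powr s * U + ((x - a) / (b - a)) powr s * V)"
  have "((\<lambda>t. \<bar>(r + 1) * t - 1\<bar> * (1 - t) powr s * U + \<bar>(r + 1) * t - 1\<bar> * t powr s * V)
      has_integral near_weight s r * U + far_weight s r * V) {0..1}"
    using assms
    by (intro has_integral_add has_integral_mult_left has_integral_near_weight has_integral_far_weight)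
  from has_integral_unit_rescale[OF this \<open>a < b\<close>]
  have wH: "((\<lambda>x. w x * H x) has_integral near_weight s r * U + far_weight s r * V) {a..b}"
  proof (rule has_integral_eq[rotated])
    fix x
    have "1 - (x - a) / (b - a) = (b - x) / (b - a)"
      using \<open>a < b\<close> by (simp add: field_simps)
    thus "(\<bar>(r + 1) * ((x - a) / (b - a)) - 1\<bar> * (1 - (x - a) / (b - a)) powr s * U
        + \<bar>(r + 1) * ((x - a) / (b - a)) - 1\<bar> * ((x - a) / (b - a)) powr s * V) / (b - a) = w x * H x"
      by (simp add: w_def H_def add_divide_distrib distrib_left mult.assoc)
  qed
  have w: "(w has_integral (1 + r\<^sup>2) / (2 * (r + 1))) {a..b}"
    unfolding w_def
    by (rule has_integral_unit_rescale[OF has_integral_total_weight]) (use assms in auto)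
  have "\<bar>((r + 1) * ((x - a) / (b - a)) - 1) * h x / (b - a)\<bar> \<le> w x * H x powr (1 / q)"
    if "x \<in> {a..b}" for x
    using mult_left_mono[OF h[OF that], of "w x"] \<open>a < b\<close>
    by (simp add: w_def H_def abs_mult)
  from powr_weighted_has_integral_bound[OF has_integral_divide[OF int, of "b - a"] w wH this]
  have "\<bar>I / (b - a)\<bar> \<le> ((1 + r\<^sup>2) / (2 * (r + 1))) powr (1 - 1 / q)
      * (near_weight s r * U + far_weight s r * V) powr (1 / q)"
    using assms by (simp add: w_def H_def add_pos_nonneg)
  thus ?thesis
    using \<open>a < b\<close> by (simp add: pos_divide_le_eq mult_ac)
qed

text \<open>Both weights are at most \<open>1\<close>. The coarse bound serves to dominate the mixed
  derivative.\<close>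

lemma s_convex_on_le_sum_endpoints:
  assumes "s_convex_on s {a..b} h" and "a < b" and "0 \<le> s" and "0 \<le> h a" and "0 \<le> h b"
    and "x \<in> {a..b}"
  shows "h x \<le> h a + h b"
proof -
  have "((b - x) / (b - a)) powr s \<le> 1" "((x - a) / (b - a)) powr s \<le> 1"
    using assms by (intro powr_le1; simp)+
  hence "((b - x) / (b - a)) powr s * h a + ((x - a) / (b - a)) powr s * h b \<le> h a + h b"
    using assms by (intro add_mono mult_left_le_one_le) auto
  thus ?thesis
    using s_convex_on_endpoints[of s a b h x] assms by simp
qed

section \<open>The estimate on the rectangle\<close>

text \<open>The desired inequality multiplied by \<open>(r\<^sub>1 + 1) * (r\<^sub>2 + 1)\<close>,
  with the derivatives given as functions \<open>P\<close> (in \<open>y\<close>) and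
  \<open>D\<close> (of \<open>P\<close> in \<open>x\<close>).\<close>

lemma mixed_deviation_bound:
  fixes f :: "real \<times> real \<Rightarrow> real" and P D :: "real \<Rightarrow> real \<Rightarrow> real"
  assumes "a < b" and "c < d" and "0 \<le> s" and "1 \<le> q" and "0 \<le> r\<^sub>1" and "0 \<le> r\<^sub>2"
    and P: "\<And>x y. x \<in> {a..b} \<Longrightarrow> y \<in> {c..d} \<Longrightarrow>
      ((\<lambda>v. f (x, v)) has_real_derivative P x y) (at y within {c..d})"
    and D: "\<And>x y. x \<in> {a..b} \<Longrightarrow> y \<in> {c..d} \<Longrightarrow>
      ((\<lambda>u. P u y) has_real_derivative D x y) (at x within {a..b})"
    and cont_c: "continuous_on {a..b} (\<lambda>x. f (x, c))"
    and convex_fst: "\<And>y. y \<in> {c..d} \<Longrightarrow> s_convex_on s {a..b} (\<lambda>u. \<bar>D u y\<bar> powr q)"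
    and convex_snd: "\<And>x. x \<in> {a..b} \<Longrightarrow> s_convex_on s {c..d} (\<lambda>v. \<bar>D x v\<bar> powr q)"
  shows "\<bar>f (a, c) + r\<^sub>2 * f (a, d) + r\<^sub>1 * f (b, c) + r\<^sub>1 * r\<^sub>2 * f (b, d)
      + (r\<^sub>1 + 1) / (b - a) * ((r\<^sub>2 + 1) / (d - c)) * integral {a..b} (\<lambda>x. integral {c..d} (\<lambda>y. f (x, y)))
      - r\<^sub>1 * ((r\<^sub>2 + 1) / (d - c)) * integral {c..d} (\<lambda>y. f (b, y))
      - (r\<^sub>2 + 1) / (d - c) * integral {c..d} (\<lambda>y. f (a, y))
      - (r\<^sub>1 + 1) / (b - a) * r\<^sub>2 * integral {a..b} (\<lambda>x. f (x, d))
      - (r\<^sub>1 + 1) / (b - a) * integral {a..b} (\<lambda>x. f (x, c))\<bar>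
    \<le> (b - a) * (d - c)
      * ((1 + r\<^sub>1\<^sup>2) / (2 * (r\<^sub>1 + 1)) * ((1 + r\<^sub>2\<^sup>2) / (2 * (r\<^sub>2 + 1)))) powr (1 - 1 / q)
      * (near_weight s r\<^sub>1 * (near_weight s r\<^sub>2 * \<bar>D a c\<bar> powr q + far_weight s r\<^sub>2 * \<bar>D a d\<bar> powr q)
         + far_weight s r\<^sub>1 * (near_weight s r\<^sub>2 * \<bar>D b c\<bar> powr q + far_weight s r\<^sub>2 * \<bar>D b d\<bar> powr q))
        powr (1 / q)"
    (is "\<bar>?E\<bar> \<le> _ * (?W\<^sub>1 * ?W\<^sub>2) powr _ * _")
proof -
  have ab: "a \<in> {a..b}" "b \<in> {a..b}" and cd: "c \<in> {c..d}" "d \<in> {c..d}"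
    using \<open>a < b\<close> \<open>c < d\<close> by auto
  note nonneg = near_weight_nonneg[OF \<open>0 \<le> s\<close> \<open>0 \<le> r\<^sub>1\<close>] far_weight_nonneg[OF \<open>0 \<le> s\<close> \<open>0 \<le> r\<^sub>1\<close>]
    near_weight_nonneg[OF \<open>0 \<le> s\<close> \<open>0 \<le> r\<^sub>2\<close>] far_weight_nonneg[OF \<open>0 \<le> s\<close> \<open>0 \<le> r\<^sub>2\<close>]
  have powr_root: "\<bar>x\<bar> = (\<bar>x\<bar> powr q) powr (1 / q)" for x
    using \<open>1 \<le> q\<close> by (simp add: powr_powr)

  \<comment> \<open>Convexity in \<open>y\<close> bounds \<open>D\<close> by the edges
    \<open>c\<close> and \<open>d\<close>, convexity in \<open>x\<close> then by the
    corners.\<close>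
  define B where "B = (\<bar>D a c\<bar> powr q + \<bar>D b c\<bar> powr q + (\<bar>D a d\<bar> powr q + \<bar>D b d\<bar> powr q)) powr (1 / q)"
  have D_le: "\<bar>D x y\<bar> \<le> B" if "x \<in> {a..b}" "y \<in> {c..d}" for x y
  proof -
    have "\<bar>D x y\<bar> powr q \<le> \<bar>D x c\<bar> powr q + \<bar>D x d\<bar> powr q"
      using assms that by (intro s_convex_on_le_sum_endpoints[of s c d]) auto
    also have "\<dots> \<le> \<bar>D a c\<bar> powr q + \<bar>D b c\<bar> powr q + (\<bar>D a d\<bar> powr q + \<bar>D b d\<bar> powr q)"
      using assms that cd
      by (intro add_mono s_convex_on_le_sum_endpoints[of s a b "\<lambda>u. \<bar>D u _\<bar> powr q"]) auto
    finally show ?thesis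
      unfolding B_def using \<open>1 \<le> q\<close> by (subst powr_root) (intro powr_mono2, auto)
  qed

  \<comment> \<open>Continuity passes from the edge \<open>c\<close> to the edge \<open>d\<close>:
    the difference \<open>f (x, d) - f (x, c)\<close> is the integral of \<open>P x\<close>, which
    is differentiable in \<open>x\<close> because \<open>D\<close> is bounded.\<close>
  have P_int: "((\<lambda>y. P x y) has_integral f (x, d) - f (x, c)) {c..d}" if "x \<in> {a..b}" for x
    using \<open>c < d\<close> P[OF that]
    by (intro fundamental_theorem_of_calculus) (auto simp: has_real_derivative_iff_has_vector_derivative)
  have "continuous_on {a..b} (\<lambda>x. integral {c..d} (P x))"
    using leibniz_rule_bounded_derivative(2)[of a b P c d D B] P_int D D_le \<open>a < b\<close>
    by (intro DERIV_continuous_on) blast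
  hence "continuous_on {a..b} (\<lambda>x. integral {c..d} (P x) + f (x, c))"
    by (intro continuous_intros cont_c)
  hence cont_d: "continuous_on {a..b} (\<lambda>x. f (x, d))"
    by (rule continuous_on_eq) (simp add: integral_unique[OF P_int])

  define k where "k = (\<lambda>y. (r\<^sub>2 + 1) * ((y - c) / (d - c)) - 1)"
  define \<phi> where "\<phi> = (\<lambda>x. f (x, c) + r\<^sub>2 * f (x, d) - (r\<^sub>2 + 1) / (d - c) * integral {c..d} (\<lambda>y. f (x, y)))"
  \<comment> \<open>Although \<open>f\<close> is not known to be differentiable in \<open>x\<close>,
    this representation makes \<open>\<phi>\<close> so, since \<open>P\<close> is.\<close>
  have \<phi>: "((\<lambda>y. k y * P x y) has_integral \<phi> x) {c..d}" if "x \<in> {a..b}" for x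
    unfolding \<phi>_def k_def using P[OF that] \<open>c < d\<close>
    by (intro has_integral_affine_kernel_derivative) auto
  \<comment> \<open>The kernel runs from \<open>- 1\<close> to \<open>r\<^sub>2\<close>; a coarse
    bound is enough for domination.\<close>
  have k_le: "\<bar>k y\<bar> \<le> r\<^sub>2 + 1" if "y \<in> {c..d}" for y
  proof -
    have "0 \<le> (y - c) / (d - c)" "(y - c) / (d - c) \<le> 1" using that \<open>c < d\<close> by auto
    from mult_nonneg_nonneg[OF _ this(1), of "r\<^sub>2 + 1"] mult_left_mono[OF this(2), of "r\<^sub>2 + 1"]
    have "0 \<le> (r\<^sub>2 + 1) * ((y - c) / (d - c))" "(r\<^sub>2 + 1) * ((y - c) / (d - c)) \<le> r\<^sub>2 + 1"
      using \<open>0 \<le> r\<^sub>2\<close> by auto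
    thus ?thesis using \<open>0 \<le> r\<^sub>2\<close> unfolding k_def abs_le_iff by linarith
  qed
  define \<phi>' where "\<phi>' = (\<lambda>x. integral {c..d} (\<lambda>y. k y * D x y))"
  have kD: "(\<lambda>y. k y * D x y) integrable_on {c..d}"
      "((\<lambda>x. integral {c..d} (\<lambda>y. k y * P x y)) has_real_derivative \<phi>' x) (at x within {a..b})"
    if "x \<in> {a..b}" for x
  proof -
    have kD_le: "\<bar>k y * D u y\<bar> \<le> (r\<^sub>2 + 1) * B" if "u \<in> {a..b}" "y \<in> {c..d}" for u y
      unfolding abs_mult using k_le D_le that \<open>0 \<le> r\<^sub>2\<close> by (intro mult_mono) auto
    have kD: "((\<lambda>u. k y * P u y) has_real_derivative k y * D u y) (at u within {a..b})"
      if "u \<in> {a..b}" "y \<in> {c..d}" for u y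
      by (intro DERIV_cmult D that)
    note leibniz = leibniz_rule_bounded_derivative[of a b "\<lambda>u y. k y * P u y" c d "\<lambda>u y. k y * D u y",
        OF has_integral_integrable[OF \<phi>] kD kD_le \<open>a < b\<close> that]
    show "(\<lambda>y. k y * D x y) integrable_on {c..d}" by (rule leibniz)
    show "((\<lambda>x. integral {c..d} (\<lambda>y. k y * P x y)) has_real_derivative \<phi>' x) (at x within {a..b})"
      unfolding \<phi>'_def by (rule leibniz)
  qed
  have \<phi>': "(\<phi> has_real_derivative \<phi>' x) (at x within {a..b})" if "x \<in> {a..b}" for x
    by (rule has_field_derivative_transform_within[OF kD(2)[OF that] zero_less_one that])
      (simp add: integral_unique[OF \<phi>])

  \<comment> \<open>Constant of the estimate in \<open>y\<close>. Dividing \<open>\<phi>'\<close> by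
    it gives the form required by the estimate in \<open>x\<close>.\<close>
  define C where "C = (d - c) * ?W\<^sub>2 powr (1 - 1 / q)"
  have "0 < ?W\<^sub>2"
    using \<open>0 \<le> r\<^sub>2\<close> by (intro divide_pos_pos add_pos_nonneg) auto
  hence "0 < C"
    unfolding C_def using \<open>c < d\<close> by (intro mult_pos_pos) auto
  define G where "G = (\<lambda>x. near_weight s r\<^sub>2 * \<bar>D x c\<bar> powr q + far_weight s r\<^sub>2 * \<bar>D x d\<bar> powr q)"
  have G_nonneg: "0 \<le> G x" for x
    unfolding G_def using nonneg by simp
  have \<phi>'_le: "\<bar>\<phi>' x\<bar> \<le> C * G x powr (1 / q)" if x: "x \<in> {a..b}" for x
    unfolding C_def G_def
  proof (rule affine_kernel_integral_bound[of c d s r\<^sub>2 q _ _ "D x"])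
    show "((\<lambda>y. ((r\<^sub>2 + 1) * ((y - c) / (d - c)) - 1) * D x y) has_integral \<phi>' x) {c..d}"
      using integrable_integral[OF kD(1)[OF x]] by (simp add: k_def \<phi>'_def)
    fix y assume "y \<in> {c..d}"
    thus "\<bar>D x y\<bar> \<le> (((d - y) / (d - c)) powr s * \<bar>D x c\<bar> powr q
        + ((y - c) / (d - c)) powr s * \<bar>D x d\<bar> powr q) powr (1 / q)"
      using \<open>1 \<le> q\<close> s_convex_on_endpoints[OF convex_snd[OF x] \<open>c < d\<close>]
      by (subst powr_root) (intro powr_mono2, auto)
  qed (use assms in auto)
  \<comment> \<open>\<open>G\<close> is a nonnegative combination of
    \<open>\<bar>D x c\<bar> powr q\<close> and \<open>\<bar>D x d\<bar> powr q\<close>, so it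
    inherits their endpoint bound in \<open>x\<close>.\<close>
  have G_le: "G x \<le> ((b - x) / (b - a)) powr s * G a + ((x - a) / (b - a)) powr s * G b"
    if "x \<in> {a..b}" for x
  proof -
    have "\<bar>D x y\<bar> powr q \<le> ((b - x) / (b - a)) powr s * \<bar>D a y\<bar> powr q
        + ((x - a) / (b - a)) powr s * \<bar>D b y\<bar> powr q" if "y \<in> {c..d}" for y
      using s_convex_on_endpoints[OF convex_fst[OF that] \<open>a < b\<close> \<open>x \<in> {a..b}\<close>] .
    from add_mono[OF mult_left_mono[OF this[OF cd(1)] nonneg(3)] mult_left_mono[OF this[OF cd(2)] nonneg(4)]]
    show ?thesis by (simp add: G_def algebra_simps)
  qed

  define I where "I = \<phi> a + r\<^sub>1 * \<phi> b - (r\<^sub>1 + 1) / (b - a) * integral {a..b} \<phi>"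
  have int_I: "((\<lambda>x. ((r\<^sub>1 + 1) * ((x - a) / (b - a)) - 1) * \<phi>' x) has_integral I) {a..b}"
    unfolding I_def using \<open>a < b\<close> \<phi>' by (rule has_integral_affine_kernel_derivative)
  have "\<bar>I / C\<bar> \<le> (b - a) * ?W\<^sub>1 powr (1 - 1 / q)
      * (near_weight s r\<^sub>1 * G a + far_weight s r\<^sub>1 * G b) powr (1 / q)"
  proof (rule affine_kernel_integral_bound[of a b s r\<^sub>1 q _ _ "\<lambda>x. \<phi>' x / C"])
    show "((\<lambda>x. ((r\<^sub>1 + 1) * ((x - a) / (b - a)) - 1) * (\<phi>' x / C)) has_integral I / C) {a..b}"
      using has_integral_divide[OF int_I, of C] by simp
    fix x assume x: "x \<in> {a..b}"
    have "\<bar>\<phi>' x / C\<bar> \<le> G x powr (1 / q)"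
      using \<phi>'_le[OF x] \<open>0 < C\<close> by (simp add: pos_divide_le_eq mult.commute)
    also have "\<dots> \<le> (((b - x) / (b - a)) powr s * G a + ((x - a) / (b - a)) powr s * G b) powr (1 / q)"
      using \<open>1 \<le> q\<close> G_nonneg G_le[OF x] by (intro powr_mono2) auto
    finally show "\<bar>\<phi>' x / C\<bar> \<le> \<dots>" .
  qed (use assms G_nonneg in auto)
  hence "\<bar>I\<bar> \<le> (b - a) * (d - c) * (?W\<^sub>1 powr (1 - 1 / q) * ?W\<^sub>2 powr (1 - 1 / q))
      * (near_weight s r\<^sub>1 * G a + far_weight s r\<^sub>1 * G b) powr (1 / q)"
    using \<open>0 < C\<close> by (simp add: pos_divide_le_eq) (simp add: C_def mult_ac)
  also have "?W\<^sub>1 powr (1 - 1 / q) * ?W\<^sub>2 powr (1 - 1 / q) = (?W\<^sub>1 * ?W\<^sub>2) powr (1 - 1 / q)"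
    by (rule powr_mult[symmetric])
  also have "I = ?E"
  proof -
    define \<psi> where "\<psi> x = integral {c..d} (\<lambda>y. f (x, y))" for x
    have f_int: "(\<lambda>x. f (x, c)) integrable_on {a..b}" "(\<lambda>x. f (x, d)) integrable_on {a..b}"
      by (intro integrable_continuous_real cont_c cont_d)+
    \<comment> \<open>Integrability of the inner integral \<open>\<psi>\<close> is recovered by
      solving the definition of \<open>\<phi>\<close> for it: \<open>\<phi>\<close> and the two edge
      functions are continuous.\<close>
    have "\<phi> integrable_on {a..b}"
      using \<phi>' by (intro integrable_continuous_real DERIV_continuous_on)
    hence "(\<lambda>x. (f (x, c) + r\<^sub>2 * f (x, d) - \<phi> x) / ((r\<^sub>2 + 1) / (d - c))) integrable_on {a..b}"
      by (intro integrable_on_divide integrable_diff integrable_add integrable_on_mult_right f_int)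
    also have "(\<lambda>x. (f (x, c) + r\<^sub>2 * f (x, d) - \<phi> x) / ((r\<^sub>2 + 1) / (d - c))) = \<psi>"
      using \<open>0 \<le> r\<^sub>2\<close> \<open>c < d\<close> by (auto simp: \<phi>_def \<psi>_def)
    finally have "\<psi> integrable_on {a..b}" .
    hence "(\<phi> has_integral integral {a..b} (\<lambda>x. f (x, c)) + r\<^sub>2 * integral {a..b} (\<lambda>x. f (x, d))
        - (r\<^sub>2 + 1) / (d - c) * integral {a..b} \<psi>) {a..b}"
      unfolding \<phi>_def \<psi>_def[symmetric]
      by (intro has_integral_diff has_integral_add has_integral_mult_right integrable_integral f_int)
    hence "integral {a..b} \<phi> = integral {a..b} (\<lambda>x. f (x, c)) + r\<^sub>2 * integral {a..b} (\<lambda>x. f (x, d))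
        - (r\<^sub>2 + 1) / (d - c) * integral {a..b} \<psi>"
      by (rule integral_unique)
    hence "I = (f (a, c) + r\<^sub>2 * f (a, d) - (r\<^sub>2 + 1) / (d - c) * \<psi> a)
        + r\<^sub>1 * (f (b, c) + r\<^sub>2 * f (b, d) - (r\<^sub>2 + 1) / (d - c) * \<psi> b)
        - (r\<^sub>1 + 1) / (b - a) * (integral {a..b} (\<lambda>x. f (x, c)) + r\<^sub>2 * integral {a..b} (\<lambda>x. f (x, d))
        - (r\<^sub>2 + 1) / (d - c) * integral {a..b} \<psi>)"
      by (simp add: I_def \<phi>_def \<psi>_def)
    also have "\<dots> = ?E"
      unfolding \<psi>_def by (simp only: distrib_left right_diff_distrib mult.assoc mult.left_commute[of r\<^sub>1])
    finally show ?thesis .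
  qed
  finally show ?thesis by (simp add: G_def)
qed

section \<open>Passage to the stated constants\<close>

theorem theorem12:
  fixes a b c d s q r\<^sub>1 r\<^sub>2 :: real
    and f :: "real \<times> real \<Rightarrow> real"
  defines "D \<equiv> mixed_partial {a..b} {c..d} f"
  defines "M \<equiv> s + 1 + 2 * (r\<^sub>1 + 1) * (r\<^sub>1 / (r\<^sub>1 + 1)) powr (s + 2) - r\<^sub>1"
    and "N \<equiv> s + 1 + 2 * (r\<^sub>2 + 1) * (r\<^sub>2 / (r\<^sub>2 + 1)) powr (s + 2) - r\<^sub>2"
    and "L \<equiv> r\<^sub>2 * (s + 1) + 2 * (1 / (r\<^sub>2 + 1)) powr (s + 1) - 1"
    and "K \<equiv> r\<^sub>1 * (s + 1) + 2 * (1 / (r\<^sub>1 + 1)) powr (s + 1) - 1"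
  assumes "a < b" and "c < d" and "{a..b} \<times> {c..d} \<subseteq> {0..} \<times> {0..}"
    and "f \<in> {a..b} \<times> {c..d} \<rightarrow> {0..}"
    and "abs_continuous_on_rect a b c d f"
    and "0 < s" and "s \<le> 1" and "1 \<le> q"
    and "r\<^sub>1 \<in> {0..1}" and "r\<^sub>2 \<in> {0..1}"
    and "has_mixed_partial_on {a..b} {c..d} f"
    and "s_convex_on_coords s {a..b} {c..d} (\<lambda>z. \<bar>D z\<bar> powr q)"
  shows "\<bar>(f (a, c) + r\<^sub>2 * f (a, d) + r\<^sub>1 * f (b, c) + r\<^sub>1 * r\<^sub>2 * f (b, d)) / ((r\<^sub>1 + 1) * (r\<^sub>2 + 1))
      + 1 / ((b - a) * (d - c)) * integral {a..b} (\<lambda>x. integral {c..d} (\<lambda>y. f (x, y)))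
      - r\<^sub>1 / (r\<^sub>1 + 1) * (1 / (d - c)) * integral {c..d} (\<lambda>y. f (b, y))
      - 1 / (r\<^sub>1 + 1) * (1 / (d - c)) * integral {c..d} (\<lambda>y. f (a, y))
      - r\<^sub>2 / (r\<^sub>2 + 1) * (1 / (b - a)) * integral {a..b} (\<lambda>x. f (x, d))
      - 1 / (r\<^sub>2 + 1) * (1 / (b - a)) * integral {a..b} (\<lambda>x. f (x, c))\<bar>
    \<le> (b - a) * (d - c) / ((r\<^sub>1 + 1) * (r\<^sub>2 + 1))
      * ((1 + r\<^sub>1\<^sup>2) * (1 + r\<^sub>2\<^sup>2) / (4 * (r\<^sub>1 + 1) * (r\<^sub>2 + 1))) powr (1 - 1 / q)
      * ((M * N * \<bar>D (a, c)\<bar> powr q + L * M * \<bar>D (a, d)\<bar> powr q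
          + K * N * \<bar>D (b, c)\<bar> powr q + K * L * \<bar>D (b, d)\<bar> powr q)
         / ((s + 1)\<^sup>2 * (s + 2)\<^sup>2)) powr (1 / q)"
proof -
  have r: "0 \<le> r\<^sub>1" "0 \<le> r\<^sub>2" using assms by auto
  \<comment> \<open>Differentiability turns the underspecified \<open>vector_derivative\<close> into
    genuine derivatives.\<close>
  have P: "((\<lambda>v. f (x, v)) has_real_derivative partial_snd {c..d} f (x, y)) (at y within {c..d})"
    and D: "((\<lambda>u. partial_snd {c..d} f (u, y)) has_real_derivative D (x, y)) (at x within {a..b})"
    if "x \<in> {a..b}" "y \<in> {c..d}" for x y
    using \<open>has_mixed_partial_on {a..b} {c..d} f\<close> that
    by (auto simp: has_mixed_partial_on_def partial_snd_def D_def mixed_partial_def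
        has_real_derivative_iff_has_vector_derivative vector_derivative_works)
  have cont: "continuous_on {a..b} (\<lambda>x. f (x, c))"
    using \<open>abs_continuous_on_rect a b c d f\<close> abs_continuous_on_imp_continuous_on
    by (auto simp: abs_continuous_on_rect_def)
  have convex: "y \<in> {c..d} \<Longrightarrow> s_convex_on s {a..b} (\<lambda>u. \<bar>D (u, y)\<bar> powr q)"
      "x \<in> {a..b} \<Longrightarrow> s_convex_on s {c..d} (\<lambda>v. \<bar>D (x, v)\<bar> powr q)" for x y
    using \<open>s_convex_on_coords s {a..b} {c..d} (\<lambda>z. \<bar>D z\<bar> powr q)\<close>
    by (auto simp: s_convex_on_coords_def)
  note bound = mixed_deviation_bound[OF \<open>a < b\<close> \<open>c < d\<close> less_imp_le[OF \<open>0 < s\<close>] \<open>1 \<le> q\<close> r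
      P D cont convex]
  have weights: "near_weight s r\<^sub>1 = M / ((s + 1) * (s + 2))" "near_weight s r\<^sub>2 = N / ((s + 1) * (s + 2))"
      "far_weight s r\<^sub>1 = K / ((s + 1) * (s + 2))" "far_weight s r\<^sub>2 = L / ((s + 1) * (s + 2))"
    by (simp_all add: near_weight_def far_weight_def M_def N_def K_def L_def)
  \<comment> \<open>To be used with \<open>S = (s + 1) * (s + 2)\<close>, one such factor coming
    from each variable.\<close>
  have sum: "M / S * (N / S * A + L / S * B) + K / S * (N / S * C + L / S * E)
      = (M * N * A + L * M * B + K * N * C + K * L * E) / S\<^sup>2" for A B C E S :: real
    by (simp add: power2_eq_square add_divide_distrib distrib_left mult_ac)
  have weight: "(1 + r\<^sub>1\<^sup>2) / (2 * (r\<^sub>1 + 1)) * ((1 + r\<^sub>2\<^sup>2) / (2 * (r\<^sub>2 + 1)))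
      = (1 + r\<^sub>1\<^sup>2) * (1 + r\<^sub>2\<^sup>2) / (4 * (r\<^sub>1 + 1) * (r\<^sub>2 + 1))"
    by (simp add: algebra_simps)
  \<comment> \<open>Here \<open>p\<close> and \<open>q\<close> stand for
    \<open>r\<^sub>1 + 1\<close> and \<open>r\<^sub>2 + 1\<close>, so this \<open>q\<close> is not
    the exponent; \<open>X\<close> and \<open>Y\<close> are the side lengths.\<close>
  have lhs: "(F + p / X * (q / Y) * J - r\<^sub>1 * (q / Y) * I1 - q / Y * I2 - p / X * r\<^sub>2 * I3 - p / X * I4) / (p * q)
      = F / (p * q) + 1 / (X * Y) * J - r\<^sub>1 / p * (1 / Y) * I1 - 1 / p * (1 / Y) * I2
        - r\<^sub>2 / q * (1 / X) * I3 - 1 / q * (1 / X) * I4"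
    if "p \<noteq> 0" "q \<noteq> 0" for F J I1 I2 I3 I4 X Y p q :: real
    using that by (simp add: diff_divide_distrib add_divide_distrib mult.commute)
  have pos: "0 < (r\<^sub>1 + 1) * (r\<^sub>2 + 1)" "r\<^sub>1 + 1 \<noteq> 0" "r\<^sub>2 + 1 \<noteq> 0"
    using r by auto
  have abs_le: "\<bar>u / p\<bar> \<le> v / p * w * z" if "\<bar>u\<bar> \<le> v * w * z" "0 < p" for u v w z p :: real
    using divide_right_mono[OF that(1), of p] that(2) by simp
  show ?thesis
    by (rule abs_le[OF bound pos(1), unfolded weights sum weight power_mult_distrib lhs[OF pos(2,3)]])
qed

end
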